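(* Let $L=\langle a,t \mid a^2,\ [t^{i}at^{-i},t^{j}at^{-j}],\ i,j\in\mathbb{Z}\rangle$ be the lamplighter group. Then $L$ does not contain any seesaw elements with respect to the generating set $X=\{t,ta\}$; that is, there are no $w\in L$, integer $k>0$ and $g\in X\cup X^{-1}$ such that $w$ is a seesaw element of swing $k$ with respect to the generator $g$.
   Context: Let $G$ be a group with finite generating set $X$, and let $|w|$ denote the word length of $w\in G$ with respect to $X$ (the least $n$ such that $w$ is a product of $n$ elements of $X\cup X^{-1}$). An element $w\in G$ is a seesaw element of swing $k>0$ with respect to a generator $g$ (where $g\in X\cup X^{-1}$) if the following conditions hold. (1) $|wg^{\pm1}|=|w|-1$ (for both signs), and $|wh^{\pm1}|\ge|w|$ for all $h\in X\smallsetminus\{g^{\pm1}\}$. (2) $|wg^{l}|=|wg^{l-1}|-1$ for all integers $l\in[1,k]$, and $|wg^{m}h^{\pm1}|\ge|wg^{m}|$ for all $h\in X\smallsetminus\{g\}$ and all integers $m\in[1,k-1]$. (3) $|wg^{-l}|=|wg^{-l+1}|-1$ for all integers $l\in[1,k]$, and $|wg^{-m}h^{\pm1}|\ge|wg^{-m}|$ for all $h\in X\smallsetminus\{g^{-1}\}$ and all integers $m\in[1,k-1]$. *)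

theory Defs
  imports "HOL-Algebra.Generated_Groups"
begin

section \<open>Groups given by generators and relators\<close>

text \<open>A letter \<open>(x, True)\<close> stands for the generator \<open>x\<close>, and \<open>(x, False)\<close> for its formal inverse.\<close>

type_synonym 'x word = "('x \<times> bool) list"

definition word_inv :: "'x word \<Rightarrow> 'x word" where
  "word_inv u = rev (map (\<lambda>(x, b). (x, \<not> b)) u)"

definition word_pow :: "'x word \<Rightarrow> int \<Rightarrow> 'x word" where
  "word_pow u i =
     (if 0 \<le> i then concat (replicate (nat i) u) else concat (replicate (nat (- i)) (word_inv u)))"

definition word_comm :: "'x word \<Rightarrow> 'x word \<Rightarrow> 'x word" where
  "word_comm u v = u @ v @ word_inv u @ word_inv v"

text \<open>The congruence on words generated by free cancellation and by \<open>r = 1\<close> for \<open>r \<in> R\<close>;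
  its quotient is the free group modulo the normal closure of \<open>R\<close>.\<close>

inductive pres_eq :: "'x word set \<Rightarrow> 'x word \<Rightarrow> 'x word \<Rightarrow> bool" for R where
  refl: "pres_eq R u u"
| sym: "pres_eq R u v \<Longrightarrow> pres_eq R v u"
| trans: "pres_eq R u v \<Longrightarrow> pres_eq R v w \<Longrightarrow> pres_eq R u w"
| cancel: "pres_eq R (p @ [(x, b), (x, \<not> b)] @ s) (p @ s)"
| relator: "r \<in> R \<Longrightarrow> pres_eq R (p @ r @ s) (p @ s)"

definition pres_rel :: "'x word set \<Rightarrow> ('x word \<times> 'x word) set" where
  "pres_rel R = {(u, v). pres_eq R u v}"

definition word_class :: "'x word set \<Rightarrow> 'x word \<Rightarrow> 'x word set" where
  "word_class R u = pres_rel R `` {u}"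

text \<open>The generating set is the whole type \<open>'x\<close>.\<close>

definition presented_group :: "'x word set \<Rightarrow> 'x word set monoid" where
  "presented_group R =
     \<lparr>carrier = UNIV // pres_rel R,
      mult = (\<lambda>P Q. \<Union>u\<in>P. \<Union>v\<in>Q. word_class R (u @ v)),
      one = word_class R []\<rparr>"

lemma equiv_pres_rel: "equiv UNIV (pres_rel R)"
proof (rule equivI)
  show "sym (pres_rel R)"
    by (auto simp: pres_rel_def sym_def intro: pres_eq.sym)
  show "trans (pres_rel R)"
    unfolding pres_rel_def trans_def by (blast intro: pres_eq.trans)
qed (auto simp: pres_rel_def refl_on_def intro: pres_eq.refl)

lemma word_class_eq_iff: "word_class R u = word_class R v \<longleftrightarrow> pres_eq R u v"
  using eq_equiv_class_iff[OF equiv_pres_rel, of u v R]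
  by (simp add: word_class_def pres_rel_def)

lemma pres_eq_context: "pres_eq R u v \<Longrightarrow> pres_eq R (p @ u @ s) (p @ v @ s)"
proof (induction rule: pres_eq.induct)
  case (cancel p' x b s')
  show ?case using pres_eq.cancel[of R "p @ p'" x b "s' @ s"] by simp
next
  case (relator r p' s')
  then show ?case using pres_eq.relator[of r R "p @ p'" "s' @ s"] by simp
qed (blast intro: pres_eq.refl pres_eq.sym pres_eq.trans)+

lemma pres_eq_append:
  assumes "pres_eq R u u'" "pres_eq R v v'"
  shows "pres_eq R (u @ v) (u' @ v')"
proof (rule pres_eq.trans)
  show "pres_eq R (u @ v) (u' @ v)" using pres_eq_context[OF assms(1), of "[]" v] by simp
  show "pres_eq R (u' @ v) (u' @ v')" using pres_eq_context[OF assms(2), of u' "[]"] by simp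
qed

lemma carrier_presented_group: "carrier (presented_group R) = range (word_class R)"
  by (auto simp: presented_group_def quotient_def word_class_def)

lemma mult_word_class:
  "word_class R u \<otimes>\<^bsub>presented_group R\<^esub> word_class R v = word_class R (u @ v)"
proof -
  have "word_class R (u' @ v') = word_class R (u @ v)"
    if "u' \<in> word_class R u" "v' \<in> word_class R v" for u' v'
  proof -
    from that have "pres_eq R u u'" "pres_eq R v v'"
      by (simp_all add: word_class_def pres_rel_def)
    then show ?thesis
      by (simp add: word_class_eq_iff pres_eq.sym pres_eq_append)
  qed
  then have "(\<Union>u'\<in>word_class R u. \<Union>v'\<in>word_class R v. word_class R (u' @ v'))
      = (\<Union>u'\<in>word_class R u. \<Union>v'\<in>word_class R v. word_class R (u @ v))"
    by simp
  moreover have "u \<in> word_class R u" "v \<in> word_class R v"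
    by (auto simp: word_class_def pres_rel_def intro: pres_eq.refl)
  ultimately show ?thesis
    by (auto simp: presented_group_def)
qed

lemma one_presented_group: "\<one>\<^bsub>presented_group R\<^esub> = word_class R []"
  by (simp add: presented_group_def)

lemma pres_eq_word_inv: "pres_eq R (word_inv u @ u) []"
proof (induction u)
  case Nil
  show ?case by (simp add: word_inv_def pres_eq.refl)
next
  case (Cons l u)
  obtain x b where l: "l = (x, b)" by (cases l)
  have "pres_eq R (word_inv (l # u) @ l # u) (word_inv u @ u)"
    using pres_eq.cancel[of R "word_inv u" x "\<not> b" u] by (simp add: l word_inv_def)
  with Cons show ?case by (blast intro: pres_eq.trans)
qed

lemma group_presented_group: "group (presented_group R)"
proof (rule groupI)
  fix P assume "P \<in> carrier (presented_group R)"
  then obtain u where u: "P = word_class R u" by (auto simp: carrier_presented_group)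
  show "\<exists>Q\<in>carrier (presented_group R). Q \<otimes>\<^bsub>presented_group R\<^esub> P = \<one>\<^bsub>presented_group R\<^esub>"
    by (rule bexI[of _ "word_class R (word_inv u)"])
      (auto simp: u mult_word_class one_presented_group word_class_eq_iff pres_eq_word_inv
        carrier_presented_group)
qed (auto simp: carrier_presented_group mult_word_class one_presented_group)


section \<open>Word length and seesaw elements\<close>

definition word_length :: "('a, 'm) monoid_scheme \<Rightarrow> 'a set \<Rightarrow> 'a \<Rightarrow> nat" where
  "word_length G X w =
     (LEAST n. \<exists>xs. length xs = n \<and> set xs \<subseteq> X \<union> m_inv G ` X \<and> foldr (mult G) xs (one G) = w)"

text \<open>
  In clauses (2) and (3) the range of \<open>h\<close> is taken literally from the usual definition, where \<open>h\<close>
  runs through \<open>X - {g}\<close> and \<open>X - {inv g}\<close> respectively. If \<open>g \<in> X\<close> and \<open>g \<noteq> inv g\<close>, then \<open>h = g\<close>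
  is not excluded in (3), which contradicts the first half of (3) as soon as \<open>k \<ge> 2\<close>
  (likewise \<open>h = inv g\<close> in (2) if \<open>inv g \<in> X\<close>); excluding \<open>g\<close> and \<open>inv g\<close> throughout would
  avoid this. The choice does not affect the non-existence of
  seesaw elements: the sets \<open>{1..k - 1}\<close> are empty for \<open>k = 1\<close>, and under either convention
  swing \<open>k\<close> implies swing \<open>1\<close> (see \<open>seesaw_imp_swing_one\<close> and \<open>seesaw_swing_one_iff\<close>).
\<close>

definition seesaw ::
  "('a, 'm) monoid_scheme \<Rightarrow> 'a set \<Rightarrow> 'a \<Rightarrow> int \<Rightarrow> 'a \<Rightarrow> bool" where
  "seesaw G X w k g \<longleftrightarrow>
     (let len = (\<lambda>v. int (word_length G X v)) in
      w \<in> carrier G \<and> 0 < k \<and> g \<in> X \<union> m_inv G ` X \<and>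
      \<comment> \<open>(1)\<close>
      len (w \<otimes>\<^bsub>G\<^esub> g) = len w - 1 \<and> len (w \<otimes>\<^bsub>G\<^esub> inv\<^bsub>G\<^esub> g) = len w - 1 \<and>
      (\<forall>h \<in> X - {g, inv\<^bsub>G\<^esub> g}. len (w \<otimes>\<^bsub>G\<^esub> h) \<ge> len w \<and> len (w \<otimes>\<^bsub>G\<^esub> inv\<^bsub>G\<^esub> h) \<ge> len w) \<and>
      \<comment> \<open>(2)\<close>
      (\<forall>l \<in> {1..k}. len (w \<otimes>\<^bsub>G\<^esub> g [^]\<^bsub>G\<^esub> l) = len (w \<otimes>\<^bsub>G\<^esub> g [^]\<^bsub>G\<^esub> (l - 1)) - 1) \<and>
      (\<forall>h \<in> X - {g}. \<forall>m \<in> {1..k - 1}.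
         len (w \<otimes>\<^bsub>G\<^esub> g [^]\<^bsub>G\<^esub> m \<otimes>\<^bsub>G\<^esub> h) \<ge> len (w \<otimes>\<^bsub>G\<^esub> g [^]\<^bsub>G\<^esub> m) \<and>
         len (w \<otimes>\<^bsub>G\<^esub> g [^]\<^bsub>G\<^esub> m \<otimes>\<^bsub>G\<^esub> inv\<^bsub>G\<^esub> h) \<ge> len (w \<otimes>\<^bsub>G\<^esub> g [^]\<^bsub>G\<^esub> m)) \<and>
      \<comment> \<open>(3)\<close>
      (\<forall>l \<in> {1..k}. len (w \<otimes>\<^bsub>G\<^esub> g [^]\<^bsub>G\<^esub> (- l)) = len (w \<otimes>\<^bsub>G\<^esub> g [^]\<^bsub>G\<^esub> (- l + 1)) - 1) \<and>
      (\<forall>h \<in> X - {inv\<^bsub>G\<^esub> g}. \<forall>m \<in> {1..k - 1}.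
         len (w \<otimes>\<^bsub>G\<^esub> g [^]\<^bsub>G\<^esub> (- m) \<otimes>\<^bsub>G\<^esub> h) \<ge> len (w \<otimes>\<^bsub>G\<^esub> g [^]\<^bsub>G\<^esub> (- m)) \<and>
         len (w \<otimes>\<^bsub>G\<^esub> g [^]\<^bsub>G\<^esub> (- m) \<otimes>\<^bsub>G\<^esub> inv\<^bsub>G\<^esub> h) \<ge> len (w \<otimes>\<^bsub>G\<^esub> g [^]\<^bsub>G\<^esub> (- m))))"

lemma seesaw_imp_swing_one: "seesaw G X w k g \<Longrightarrow> seesaw G X w 1 g"
  by (auto simp: seesaw_def Let_def)

lemma (in group) seesaw_swing_one_iff:
  assumes "X \<subseteq> carrier G"
  shows "seesaw G X w 1 g \<longleftrightarrow>
    w \<in> carrier G \<and> g \<in> X \<union> m_inv G ` X \<and>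
    int (word_length G X (w \<otimes> g)) = int (word_length G X w) - 1 \<and>
    int (word_length G X (w \<otimes> inv g)) = int (word_length G X w) - 1 \<and>
    (\<forall>h \<in> X - {g, inv g}. word_length G X (w \<otimes> h) \<ge> word_length G X w \<and>
                          word_length G X (w \<otimes> inv h) \<ge> word_length G X w)"
proof (cases "w \<in> carrier G \<and> g \<in> X \<union> m_inv G ` X")
  case True
  with assms have "g \<in> carrier G" by auto
  moreover from this have "g [^] (-1::int) = inv g" by (simp add: int_pow_neg)
  ultimately show ?thesis using True by (simp add: seesaw_def Let_def) blast
qed (auto simp: seesaw_def Let_def)


section \<open>The lamplighter group\<close>

datatype lamp_gen = gen_a | gen_t

definition lamplighter_relators :: "lamp_gen word set" where
  "lamplighter_relators =
     (let a = [(gen_a, True)]; t = [(gen_t, True)];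
          conj = (\<lambda>i. word_pow t i @ a @ word_pow t (- i))
      in {word_pow a 2} \<union> {word_comm (conj i) (conj j) | i j. True})"

definition lamplighter :: "lamp_gen word set monoid" where
  "lamplighter = presented_group lamplighter_relators"

definition lamp_a :: "lamp_gen word set" where
  "lamp_a = word_class lamplighter_relators [(gen_a, True)]"

definition lamp_t :: "lamp_gen word set" where
  "lamp_t = word_class lamplighter_relators [(gen_t, True)]"

lemma group_lamplighter: "group lamplighter"
  by (simp add: lamplighter_def group_presented_group)

lemma lamp_closed: "lamp_a \<in> carrier lamplighter" "lamp_t \<in> carrier lamplighter"
  by (auto simp: lamplighter_def lamp_a_def lamp_t_def carrier_presented_group)

lemma generate_lamplighter:
  "generate lamplighter {lamp_t, lamp_t \<otimes>\<^bsub>lamplighter\<^esub> lamp_a} = carrier lamplighter"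
proof -
  interpret group lamplighter by (rule group_lamplighter)
  let ?R = lamplighter_relators
  let ?X = "{lamp_t, lamp_t \<otimes>\<^bsub>lamplighter\<^esub> lamp_a}"
  have X: "?X \<subseteq> carrier lamplighter" using lamp_closed by auto
  interpret H: subgroup "generate lamplighter ?X" lamplighter
    by (rule generate_is_subgroup[OF X])
  have t: "lamp_t \<in> generate lamplighter ?X"
    and ta: "lamp_t \<otimes>\<^bsub>lamplighter\<^esub> lamp_a \<in> generate lamplighter ?X"
    by (auto intro: generate.incl)
  have "inv\<^bsub>lamplighter\<^esub> lamp_t \<otimes>\<^bsub>lamplighter\<^esub> (lamp_t \<otimes>\<^bsub>lamplighter\<^esub> lamp_a)
      \<in> generate lamplighter ?X"
    using t ta by blast
  then have a: "lamp_a \<in> generate lamplighter ?X"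
    using lamp_closed by (simp add: inv_solve_left' m_assoc[symmetric])
  have pos: "word_class ?R [(x, True)] \<in> generate lamplighter ?X" for x
    using a t by (cases x) (auto simp: lamp_a_def lamp_t_def)
  have neg: "word_class ?R [(x, False)] = inv\<^bsub>lamplighter\<^esub> (word_class ?R [(x, True)])" for x
  proof (rule inv_equality[symmetric])
    show "word_class ?R [(x, False)] \<otimes>\<^bsub>lamplighter\<^esub> word_class ?R [(x, True)] = \<one>\<^bsub>lamplighter\<^esub>"
      using pres_eq.cancel[of ?R "[]" x False "[]"]
      by (simp add: lamplighter_def mult_word_class one_presented_group word_class_eq_iff)
  qed (auto simp: lamplighter_def carrier_presented_group)
  have letter: "word_class ?R [l] \<in> generate lamplighter ?X" for l
    by (cases l; cases "snd l") (auto simp: pos neg)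
  have "word_class ?R u \<in> generate lamplighter ?X" for u
  proof (induction u)
    case Nil
    show ?case using H.one_closed by (simp add: lamplighter_def one_presented_group)
  next
    case (Cons l u)
    have "word_class ?R (l # u) = word_class ?R [l] \<otimes>\<^bsub>lamplighter\<^esub> word_class ?R u"
      by (simp add: lamplighter_def mult_word_class)
    with Cons letter show ?case by auto
  qed
  then have "carrier lamplighter \<subseteq> generate lamplighter ?X"
    by (auto simp: lamplighter_def carrier_presented_group)
  with generate_incl[OF X] show ?thesis by blast
qed

end

theory Submission
  imports Defs
begin

text \<open>
  An element of the lamplighter group is a state \<open>(S, p)\<close>, where \<open>S\<close> is the finite set of lit lamps
  and \<open>p\<close> the position of the lamplighter. Put lamp \<open>i\<close> on the edge from \<open>i - 1\<close> to \<open>i\<close>: the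
  generators \<open>t\<close> and \<open>ta\<close> then move along one edge, \<open>ta\<close> toggling its lamp. So the word length is
  the length of a shortest path from \<open>0\<close> to \<open>p\<close> that crosses every lit edge, which is
  \<open>2 (M - m) - \<bar>p\<bar>\<close> if \<open>[m, M]\<close> is the hull of \<open>0\<close>, \<open>p\<close> and the lit edges.

  If \<open>p > 0\<close>, a step to the left shortens only when \<open>M = p\<close>, and then no step to the right does;
  the case \<open>p < 0\<close> is symmetric. If \<open>p = 0\<close>, a step to the right shortens precisely when \<open>M > 0\<close>,
  whichever of the two generators is used, so clause (1) fails for the other generator.
\<close>

section \<open>Word length and products in groups\<close>

context group
begin

lemma foldr_mult_closed:
  "set xs \<subseteq> carrier G \<Longrightarrow> foldr (\<otimes>) xs \<one> \<in> carrier G"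
  by (induction xs) auto

lemma foldr_mult_append:
  "set xs \<subseteq> carrier G \<Longrightarrow> set ys \<subseteq> carrier G \<Longrightarrow>
    foldr (\<otimes>) (xs @ ys) \<one> = foldr (\<otimes>) xs \<one> \<otimes> foldr (\<otimes>) ys \<one>"
  by (induction xs) (auto simp: m_assoc foldr_mult_closed)

text \<open>By \<open>one\<close> and \<open>step\<close>, \<open>len\<close> is at most the number
  of factors in any product. Conversely, following descents until the identity is reached writes an
  element as a product of at most \<open>len\<close> many factors. This reduces a word length
  computation to local conditions on a candidate function.\<close>

lemma word_length_eqI:
  fixes len :: "'a \<Rightarrow> nat"
  assumes X: "X \<subseteq> carrier G"
    and one: "len \<one> = 0"
    and step: "\<And>v x. v \<in> carrier G \<Longrightarrow> x \<in> X \<union> m_inv G ` X \<Longrightarrow> len (v \<otimes> x) \<le> Suc (len v)"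
    and descent: "\<And>v. v \<in> carrier G \<Longrightarrow> v \<noteq> \<one> \<Longrightarrow> \<exists>x \<in> X \<union> m_inv G ` X. len (v \<otimes> x) < len v"
    and w: "w \<in> carrier G"
  shows "word_length G X w = len w"
proof -
  let ?Y = "X \<union> m_inv G ` X"
  have Y: "?Y \<subseteq> carrier G" using X by auto
  have inv_Y: "inv x \<in> ?Y" if "x \<in> ?Y" for x using that X by (auto simp: subset_iff)
  have lower: "len (foldr (\<otimes>) xs \<one>) \<le> length xs" if "set xs \<subseteq> ?Y" for xs
    using that
  proof (induction xs rule: rev_induct)
    case (snoc x xs)
    then have "set xs \<subseteq> carrier G" "x \<in> carrier G" using Y by auto
    then have "foldr (\<otimes>) (xs @ [x]) \<one> = foldr (\<otimes>) xs \<one> \<otimes> x"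
      using foldr_mult_append[of xs "[x]"] by simp
    moreover have "len (foldr (\<otimes>) xs \<one> \<otimes> x) \<le> Suc (len (foldr (\<otimes>) xs \<one>))"
      using snoc.prems \<open>set xs \<subseteq> carrier G\<close> by (intro step foldr_mult_closed) auto
    ultimately show ?case using snoc by simp
  qed (simp add: one)
  have upper: "\<exists>xs. length xs \<le> len v \<and> set xs \<subseteq> ?Y \<and> foldr (\<otimes>) xs \<one> = v"
    if "v \<in> carrier G" for v
    using that
  proof (induction "len v" arbitrary: v rule: less_induct)
    case less
    show ?case
    proof (cases "v = \<one>")
      case True
      then show ?thesis by (intro exI[of _ "[]"]) auto
    next
      case False
      then obtain x where x: "x \<in> ?Y" "len (v \<otimes> x) < len v" using descent less.prems by blast
      have xc: "x \<in> carrier G" using x(1) Y by auto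
      then obtain xs where xs: "length xs \<le> len (v \<otimes> x)" "set xs \<subseteq> ?Y"
        "foldr (\<otimes>) xs \<one> = v \<otimes> x"
        using less.hyps[OF x(2)] less.prems by auto
      \<comment> \<open>The descent from \<open>v\<close> to \<open>v \<otimes> x\<close> is undone
        by a last factor \<open>inv x\<close>, which lies in \<open>?Y\<close> because
        \<open>?Y\<close> is closed under inverses.\<close>
      have "set xs \<subseteq> carrier G" using xs(2) Y by blast
      then have "foldr (\<otimes>) (xs @ [inv x]) \<one> = v \<otimes> x \<otimes> inv x"
        using foldr_mult_append[of xs "[inv x]"] xs(3) xc by simp
      also have "\<dots> = v" using xc less.prems by (simp add: m_assoc)
      finally show ?thesis
        using xs x inv_Y[OF x(1)] by (intro exI[of _ "xs @ [inv x]"]) auto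
    qed
  qed
  obtain xs where xs: "length xs \<le> len w" "set xs \<subseteq> ?Y" "foldr (\<otimes>) xs \<one> = w"
    using upper[OF w] by blast
  with lower[OF xs(2)] have "length xs = len w" by simp
  with xs have "\<exists>xs. length xs = len w \<and> set xs \<subseteq> ?Y \<and> foldr (\<otimes>) xs \<one> = w" by blast
  moreover have "len w \<le> n"
    if "\<exists>xs. length xs = n \<and> set xs \<subseteq> ?Y \<and> foldr (\<otimes>) xs \<one> = w" for n
    using that lower by auto
  ultimately show ?thesis
    unfolding word_length_def by (rule Least_equality)
qed

text \<open>Two equal factors can be moved next to each other and cancelled. This shortens the list
  by two and preserves all parities.\<close>

lemma commuting_involutions_prod:
  assumes closed: "\<And>x. f x \<in> carrier G"
    and comm: "\<And>x y. f x \<otimes> f y = f y \<otimes> f x"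
    and invol: "\<And>x. f x \<otimes> f x = \<one>"
    and even: "\<And>x. even (count_list xs x)"
  shows "foldr (\<otimes>) (map f xs) \<one> = \<one>"
  using even
proof (induction "length xs" arbitrary: xs rule: less_induct)
  case less
  define P where "P xs = foldr (\<otimes>) (map f xs) \<one>" for xs
  have P_simps [simp]: "P [] = \<one>" "P (x # xs) = f x \<otimes> P xs" for x xs
    by (simp_all only: P_def list.map foldr.simps o_apply id_apply)
  have P_closed [simp]: "P xs \<in> carrier G" for xs
    by (induction xs) (auto simp: closed)
  have P_append: "P (xs @ ys) = P xs \<otimes> P ys" for xs ys
    by (induction xs) (auto simp: m_assoc closed)
  have f_P: "f x \<otimes> P xs = P xs \<otimes> f x" for x xs
  proof (induction xs)
    case (Cons y xs)
    have "f x \<otimes> P (y # xs) = f y \<otimes> (f x \<otimes> P xs)"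
      using comm[of x y] by (simp add: m_assoc[symmetric] closed)
    also have "\<dots> = P (y # xs) \<otimes> f x"
      by (simp add: Cons m_assoc closed)
    finally show ?case .
  qed (simp add: closed)
  have "P xs = \<one>"
  proof (cases xs)
    case (Cons x ys)
    \<comment> \<open>If \<open>x\<close> occurred only at the head, its count would be 1, which is
      odd.\<close>
    have "x \<in> set ys"
    proof (rule ccontr)
      assume "x \<notin> set ys"
      then show False using less.prems[of x] Cons by (simp add: count_list_0_iff)
    qed
    then obtain us vs where ys: "ys = us @ x # vs" by (meson split_list)
    have "P xs = (f x \<otimes> P us) \<otimes> (f x \<otimes> P vs)"
      by (simp add: Cons ys P_append m_assoc closed)
    \<comment> \<open>The first \<open>f x\<close> is moved past \<open>P us\<close> to meet the
      second one.\<close>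
    also have "\<dots> = P us \<otimes> ((f x \<otimes> f x) \<otimes> P vs)"
      by (simp only: f_P[of x us]) (simp only: m_assoc closed P_closed m_closed)
    also have "\<dots> = P (us @ vs)"
      by (simp add: invol P_append)
    also have "\<dots> = \<one>"
      unfolding P_def
    proof (rule less.hyps)
      show "even (count_list (us @ vs) y)" for y
        using less.prems[of y] by (simp add: Cons ys split: if_splits)
    qed (simp add: Cons ys)
    finally show ?thesis .
  qed simp
  then show ?case by (simp only: P_def)
qed

end

section \<open>Inverses and powers of word classes\<close>

lemma inv_word_class:
  "inv\<^bsub>presented_group R\<^esub> (word_class R u) = word_class R (word_inv u)"
  by (rule group.inv_equality[OF group_presented_group])
    (auto simp: mult_word_class one_presented_group word_class_eq_iff pres_eq_word_inv
      carrier_presented_group)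

lemma word_class_word_pow:
  "word_class R (word_pow u i) = word_class R u [^]\<^bsub>presented_group R\<^esub> i"
proof -
  interpret group "presented_group R" by (rule group_presented_group)
  have pow: "word_class R (concat (replicate n u)) = word_class R u [^]\<^bsub>presented_group R\<^esub> n"
    for n :: nat and u :: "'a word"
  proof (induction n)
    case (Suc n)
    have "word_class R (concat (replicate (Suc n) u))
        = word_class R u \<otimes>\<^bsub>presented_group R\<^esub> word_class R u [^]\<^bsub>presented_group R\<^esub> n"
      by (simp only: replicate_Suc concat.simps Suc[symmetric] mult_word_class)
    then show ?case
      using nat_pow_Suc2[of "word_class R u" n] by (simp only: carrier_presented_group rangeI)
  qed (simp add: one_presented_group)
  have u: "word_class R u \<in> carrier (presented_group R)" by (simp add: carrier_presented_group)
  show ?thesis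
  proof (cases "0 \<le> i")
    case True
    then have "\<not> i < 0" by simp
    with True show ?thesis
      by (simp only: word_pow_def if_True pow int_pow_def2 if_False)
  next
    case False
    then have "i < 0" by simp
    with False show ?thesis
      by (simp only: word_pow_def if_False pow int_pow_def2 if_True
          inv_word_class[symmetric] nat_pow_inv[OF u])
  qed
qed

section \<open>Lamp states\<close>

definition toggle :: "'a \<Rightarrow> 'a set \<Rightarrow> 'a set" where
  "toggle q S = (if q \<in> S then S - {q} else insert q S)"

lemma toggle_simps [simp]:
  "toggle q (toggle q S) = S" "toggle q S - {q} = S - {q}" "finite (toggle q S) = finite S"
  "x \<in> toggle q S \<longleftrightarrow> (x \<in> S \<longleftrightarrow> x \<noteq> q)"
  by (auto simp: toggle_def)

lemma toggle_commute: "toggle q (toggle r S) = toggle r (toggle q S)"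
  by (auto simp: set_eq_iff)

type_synonym lamp_state = "int set \<times> int"

text \<open>Words are read from left to right, so appending a letter corresponds to right
  multiplication. Both signs of \<open>gen_a\<close> toggle, because the relator \<open>a^2\<close>
  makes \<open>a\<close> its own inverse.\<close>

fun act :: "lamp_state \<Rightarrow> lamp_gen \<times> bool \<Rightarrow> lamp_state" where
  "act (S, p) (gen_a, b) = (toggle p S, p)"
| "act (S, p) (gen_t, b) = (S, if b then p + 1 else p - 1)"

abbreviation run :: "lamp_state \<Rightarrow> lamp_gen word \<Rightarrow> lamp_state" where
  "run \<equiv> foldl act"

lemma act_cancel: "act (act s (x, b)) (x, \<not> b) = s"
  by (cases s; cases x) auto

lemma run_word_pow_t: "run (S, p) (word_pow [(gen_t, True)] i) = (S, p + i)"
proof -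
  have "run (S, p) (concat (replicate n [(gen_t, b)])) = (S, if b then p + int n else p - int n)"
    for n b p by (induction n arbitrary: p) auto
  then show ?thesis by (auto simp: word_pow_def word_inv_def)
qed

lemma run_word_inv: "run (run s u) (word_inv u) = s"
proof (induction u arbitrary: s)
  case (Cons l u)
  obtain x b where "l = (x, b)" by (cases l)
  with Cons show ?case by (simp add: word_inv_def act_cancel)
qed (simp add: word_inv_def)

abbreviation lamp_conj :: "int \<Rightarrow> lamp_gen word" where
  "lamp_conj i \<equiv> word_pow [(gen_t, True)] i @ [(gen_a, True)] @ word_pow [(gen_t, True)] (- i)"

lemma run_lamp_conj: "run (S, p) (lamp_conj i) = (toggle (p + i) S, p)"
  by (simp add: run_word_pow_t)

text \<open>A conjugate \<open>lamp_conj i\<close> walks to lamp \<open>p + i\<close>, toggles it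
  and walks back. A commutator therefore performs each of its two toggles twice.\<close>

lemma run_relator:
  assumes "r \<in> lamplighter_relators"
  shows "run s r = s"
proof -
  obtain S p where s: "s = (S, p)" by (cases s)
  consider "r = [(gen_a, True), (gen_a, True)]"
    | i j where "r = word_comm (lamp_conj i) (lamp_conj j)"
    using assms by (auto simp: lamplighter_relators_def word_pow_def Let_def numeral_2_eq_2)
  then show ?thesis
  proof cases
    case 2
    \<comment> \<open>From the toggled state, \<open>lamp_conj i\<close> leads to
      \<open>(S, p)\<close>; the inverse word runs back, so it toggles the same lamp.\<close>
    have inv: "run (S, p) (word_inv (lamp_conj i)) = (toggle (p + i) S, p)" for S p i
      using run_word_inv[of "(toggle (p + i) S, p)" "lamp_conj i"]
      unfolding run_lamp_conj by simp
    \<comment> \<open>\<open>foldl_append\<close> also splits the words inside the conjugates, so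
      the two run equations are brought into the same split form.\<close>
    show ?thesis
      unfolding 2 word_comm_def foldl_append s
        inv[unfolded foldl_append] run_lamp_conj[unfolded foldl_append]
      by (simp add: toggle_commute[of "p + i" "p + j"])
  qed (simp add: s)
qed

lemma run_pres_eq: "pres_eq lamplighter_relators u v \<Longrightarrow> run s u = run s v"
proof (induction arbitrary: s rule: pres_eq.induct)
  case (relator r p q)
  then show ?case by (simp add: run_relator)
qed (simp_all add: act_cancel)

section \<open>The group acting on lamp states\<close>

definition lamp_state :: "lamp_gen word set \<Rightarrow> lamp_state" where
  "lamp_state P = run ({}, 0) (SOME u. word_class lamplighter_relators u = P)"

text \<open>The word chosen by \<open>SOME\<close> is congruent to \<open>u\<close>, and congruent
  words act alike by \<open>run_pres_eq\<close>.\<close>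

lemma lamp_state_word_class:
  "lamp_state (word_class lamplighter_relators u) = run ({}, 0) u"
proof -
  have "word_class lamplighter_relators (SOME v. word_class lamplighter_relators v
      = word_class lamplighter_relators u) = word_class lamplighter_relators u"
    by (rule someI) (rule HOL.refl)
  then show ?thesis
    unfolding lamp_state_def word_class_eq_iff by (rule run_pres_eq)
qed

lemma lamp_state_mult:
  assumes "w \<in> carrier lamplighter"
  shows "lamp_state (w \<otimes>\<^bsub>lamplighter\<^esub> word_class lamplighter_relators v) = run (lamp_state w) v"
  using assms
  by (auto simp: lamplighter_def carrier_presented_group mult_word_class lamp_state_word_class)

lemma lamp_state_one: "lamp_state \<one>\<^bsub>lamplighter\<^esub> = ({}, 0)"
  by (simp add: lamplighter_def one_presented_group lamp_state_word_class)

lemma finite_lamp_state: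
  assumes "w \<in> carrier lamplighter"
  shows "finite (fst (lamp_state w))"
proof -
  have act: "finite (fst s) \<Longrightarrow> finite (fst (act s l))" for s l
    by (cases "(s, l)" rule: act.cases) auto
  have "finite (fst s) \<Longrightarrow> finite (fst (run s u))" for s u
    by (induction u arbitrary: s) (auto simp: act)
  with assms show ?thesis
    by (auto simp: lamplighter_def carrier_presented_group lamp_state_word_class)
qed

section \<open>Normal forms and faithfulness of the state map\<close>

lemma word_class_closed: "word_class lamplighter_relators u \<in> carrier lamplighter"
  by (simp add: lamplighter_def carrier_presented_group)

lemma word_class_aa:
  "word_class lamplighter_relators [(gen_a, True), (gen_a, True)] = \<one>\<^bsub>lamplighter\<^esub>"
  using pres_eq.relator[of "[(gen_a, True), (gen_a, True)]" lamplighter_relators "[]" "[]"]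
  by (simp add: lamplighter_relators_def word_pow_def Let_def numeral_2_eq_2
      lamplighter_def one_presented_group word_class_eq_iff)

text \<open>Induction on a word, one letter at a time: a letter \<open>a\<close> read at position
  \<open>p\<close> appends a factor \<open>c p\<close> to the product, and a letter \<open>t\<close>
  or its inverse changes only the exponent of \<open>lamp_t\<close>. A lamp is lit when its factor
  occurs an odd number of times.\<close>

lemma lamp_state_normal_form:
  fixes c :: "int \<Rightarrow> lamp_gen word set"
  defines "c \<equiv> \<lambda>i. word_class lamplighter_relators (lamp_conj i)"
  assumes w: "w \<in> carrier lamplighter"
  shows "\<exists>xs. fst (lamp_state w) = {q. odd (count_list xs q)} \<and>
    w = foldr (\<otimes>\<^bsub>lamplighter\<^esub>) (map c xs) \<one>\<^bsub>lamplighter\<^esub>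
      \<otimes>\<^bsub>lamplighter\<^esub> lamp_t [^]\<^bsub>lamplighter\<^esub> snd (lamp_state w)"
proof -
  interpret group lamplighter by (rule group_lamplighter)
  let ?R = lamplighter_relators
  let ?P = "\<lambda>xs. foldr (\<otimes>\<^bsub>lamplighter\<^esub>) (map c xs) \<one>\<^bsub>lamplighter\<^esub>"
  note mult = mult_word_class[of ?R, folded lamplighter_def]
  have P_closed: "?P xs \<in> carrier lamplighter" for xs
    by (rule foldr_mult_closed) (auto simp: c_def word_class_closed)
  have c: "c i = lamp_t [^]\<^bsub>lamplighter\<^esub> i \<otimes>\<^bsub>lamplighter\<^esub> lamp_a
      \<otimes>\<^bsub>lamplighter\<^esub> lamp_t [^]\<^bsub>lamplighter\<^esub> (- i)" for i
    unfolding lamplighter_def c_def lamp_t_def lamp_a_def word_class_word_pow[symmetric]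
    by (simp add: mult_word_class)
  have a_inv: "word_class ?R [(gen_a, b)] = lamp_a" for b
  proof -
    have "lamp_a \<otimes>\<^bsub>lamplighter\<^esub> lamp_a = \<one>\<^bsub>lamplighter\<^esub>"
      using word_class_aa by (simp add: lamp_a_def lamplighter_def mult_word_class)
    then have "inv\<^bsub>lamplighter\<^esub> lamp_a = lamp_a"
      using lamp_closed by (simp add: inv_equality)
    then have "word_class ?R [(gen_a, False)] = lamp_a"
      by (simp add: lamp_a_def lamplighter_def inv_word_class word_inv_def)
    then show ?thesis by (cases b) (simp_all add: lamp_a_def)
  qed
  have t_pow: "word_class ?R [(gen_t, b)] = lamp_t [^]\<^bsub>lamplighter\<^esub> (if b then 1 else -1 :: int)" for b
    using lamp_closed(2)
    by (simp add: int_pow_neg) (simp add: lamp_t_def lamplighter_def inv_word_class word_inv_def)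
  obtain u where u: "w = word_class ?R u"
    using w by (auto simp: lamplighter_def carrier_presented_group)
  have "\<exists>xs. fst (run ({}, 0) u) = {q. odd (count_list xs q)} \<and>
    word_class ?R u = ?P xs \<otimes>\<^bsub>lamplighter\<^esub> lamp_t [^]\<^bsub>lamplighter\<^esub> snd (run ({}, 0) u)"
  proof (induction u rule: rev_induct)
    case Nil
    have "word_class ?R [] = \<one>\<^bsub>lamplighter\<^esub>" by (simp add: lamplighter_def one_presented_group)
    then show ?case by (intro exI[of _ "[]"]) simp
  next
    case (snoc l u)
    obtain S p where run: "run ({}, 0) u = (S, p)" by fastforce
    obtain xs where xs: "S = {q. odd (count_list xs q)}"
      "word_class ?R u = ?P xs \<otimes>\<^bsub>lamplighter\<^esub> lamp_t [^]\<^bsub>lamplighter\<^esub> p"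
      using snoc run by auto
    have step: "word_class ?R (u @ [l])
        = ?P xs \<otimes>\<^bsub>lamplighter\<^esub> lamp_t [^]\<^bsub>lamplighter\<^esub> p \<otimes>\<^bsub>lamplighter\<^esub> word_class ?R [l]"
      by (simp add: mult[symmetric] xs)
    obtain x b where l: "l = (x, b)" by (cases l)
    show ?case
    proof (cases x)
      case gen_a
      have "?P (xs @ [p]) = ?P xs \<otimes>\<^bsub>lamplighter\<^esub> c p"
        using foldr_mult_append[of "map c xs" "map c [p]"]
        by (simp add: c_def word_class_closed image_subset_iff)
      \<comment> \<open>This is \<open>c p t^p = t^p a\<close>: the new \<open>a\<close> moves left
        across the power of \<open>t\<close> by turning into the conjugate
        \<open>c p\<close>.\<close>
      moreover have "c p \<otimes>\<^bsub>lamplighter\<^esub> lamp_t [^]\<^bsub>lamplighter\<^esub> p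
          = lamp_t [^]\<^bsub>lamplighter\<^esub> p \<otimes>\<^bsub>lamplighter\<^esub> lamp_a"
        using lamp_closed by (simp add: c m_assoc int_pow_neg)
      ultimately have "word_class ?R (u @ [l])
          = ?P (xs @ [p]) \<otimes>\<^bsub>lamplighter\<^esub> lamp_t [^]\<^bsub>lamplighter\<^esub> p"
        using step a_inv lamp_closed P_closed word_class_closed
        by (simp add: l gen_a m_assoc c_def)
      moreover have "fst (run ({}, 0) (u @ [l])) = {q. odd (count_list (xs @ [p]) q)}"
        by (auto simp: run l gen_a xs(1))
      ultimately show ?thesis
        using run by (intro exI[of _ "xs @ [p]"]) (simp add: l gen_a)
    next
      case gen_t
      have "word_class ?R (u @ [l])
          = ?P xs \<otimes>\<^bsub>lamplighter\<^esub> lamp_t [^]\<^bsub>lamplighter\<^esub> (p + (if b then 1 else - 1))"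
        using step lamp_closed P_closed
        by (simp only: l gen_t t_pow m_assoc int_pow_closed int_pow_mult)
      then show ?thesis
        using run xs(1) by (intro exI[of _ xs]) (auto simp: l gen_t)
    qed
  qed
  then show ?thesis by (simp add: u lamp_state_word_class)
qed

text \<open>Equal states give normal forms with the same power of \<open>lamp_t\<close> and with
  factors of equal parities. Since the conjugates are commuting involutions by the relators, the two
  products agree.\<close>

lemma inj_on_lamp_state: "inj_on lamp_state (carrier lamplighter)"
proof (rule inj_onI)
  interpret group lamplighter by (rule group_lamplighter)
  let ?R = lamplighter_relators
  let ?c = "\<lambda>i. word_class ?R (lamp_conj i)"
  let ?P = "\<lambda>xs. foldr (\<otimes>\<^bsub>lamplighter\<^esub>) (map ?c xs) \<one>\<^bsub>lamplighter\<^esub>"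
  have P_closed: "?P xs \<in> carrier lamplighter" for xs
    by (rule foldr_mult_closed) (auto simp: word_class_closed)
  have even_prod: "?P xs = \<one>\<^bsub>lamplighter\<^esub>" if "\<And>q. even (count_list xs q)" for xs
  proof (rule commuting_involutions_prod)
    fix i j
    have "word_comm (lamp_conj i) (lamp_conj j) \<in> ?R"
      unfolding lamplighter_relators_def Let_def by blast
    then have "pres_eq ?R (word_comm (lamp_conj i) (lamp_conj j)) []"
      using pres_eq.relator[of "word_comm (lamp_conj i) (lamp_conj j)" ?R "[]" "[]"] by simp
    then have "word_class ?R (word_comm (lamp_conj i) (lamp_conj j)) = \<one>\<^bsub>lamplighter\<^esub>"
      by (simp add: word_class_eq_iff lamplighter_def one_presented_group)
    then have "?c i \<otimes>\<^bsub>lamplighter\<^esub> (?c j \<otimes>\<^bsub>lamplighter\<^esub>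
        (inv\<^bsub>lamplighter\<^esub> ?c i \<otimes>\<^bsub>lamplighter\<^esub> inv\<^bsub>lamplighter\<^esub> ?c j)) = \<one>\<^bsub>lamplighter\<^esub>"
      unfolding word_comm_def lamplighter_def inv_word_class mult_word_class .
    \<comment> \<open>The commutator relation is regrouped as \<open>x y (y x)^-1 = 1\<close>, from
      which \<open>x y = y x\<close> follows by uniqueness of inverses.\<close>
    then have "(?c i \<otimes>\<^bsub>lamplighter\<^esub> ?c j) \<otimes>\<^bsub>lamplighter\<^esub> inv\<^bsub>lamplighter\<^esub> (?c j \<otimes>\<^bsub>lamplighter\<^esub> ?c i)
        = \<one>\<^bsub>lamplighter\<^esub>"
      by (simp only: inv_mult_group word_class_closed m_assoc m_closed inv_closed)
    then have "inv\<^bsub>lamplighter\<^esub> (inv\<^bsub>lamplighter\<^esub> (?c j \<otimes>\<^bsub>lamplighter\<^esub> ?c i))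
        = ?c i \<otimes>\<^bsub>lamplighter\<^esub> ?c j"
      by (intro inv_equality m_closed inv_closed word_class_closed)
    then show "?c i \<otimes>\<^bsub>lamplighter\<^esub> ?c j = ?c j \<otimes>\<^bsub>lamplighter\<^esub> ?c i"
      by (simp only: inv_inv m_closed word_class_closed)
  next
    fix i
    \<comment> \<open>The conjugate is written as \<open>T a T^-1\<close>; in its square
      \<open>T^-1 T\<close> cancels first, then \<open>a a\<close>, then
      \<open>T T^-1\<close>.\<close>
    have "?c i = word_class ?R [(gen_t, True)] [^]\<^bsub>lamplighter\<^esub> i \<otimes>\<^bsub>lamplighter\<^esub>
        (word_class ?R [(gen_a, True)] \<otimes>\<^bsub>lamplighter\<^esub>
          inv\<^bsub>lamplighter\<^esub> (word_class ?R [(gen_t, True)] [^]\<^bsub>lamplighter\<^esub> i))"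
      (is "_ = ?t \<otimes>\<^bsub>_\<^esub> (?a \<otimes>\<^bsub>_\<^esub> _)")
      using word_class_closed
      by (simp add: int_pow_neg[symmetric])
        (simp add: lamplighter_def word_class_word_pow[symmetric] mult_word_class)
    moreover have "?t \<in> carrier lamplighter" "?a \<in> carrier lamplighter"
      by (simp_all add: word_class_closed)
    moreover have "?a \<otimes>\<^bsub>lamplighter\<^esub> (?a \<otimes>\<^bsub>lamplighter\<^esub> x) = x" if "x \<in> carrier lamplighter" for x
      using that word_class_aa by (simp add: m_assoc[symmetric] word_class_closed)
        (simp add: lamplighter_def mult_word_class)
    moreover have "inv\<^bsub>lamplighter\<^esub> ?t \<otimes>\<^bsub>lamplighter\<^esub> (?t \<otimes>\<^bsub>lamplighter\<^esub> x) = x"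
      if "x \<in> carrier lamplighter" for x
      using that by (simp add: m_assoc[symmetric] word_class_closed)
    ultimately show "?c i \<otimes>\<^bsub>lamplighter\<^esub> ?c i = \<one>\<^bsub>lamplighter\<^esub>"
      by (simp add: m_assoc)
  qed (use that word_class_closed in auto)
  fix v w assume vw: "v \<in> carrier lamplighter" "w \<in> carrier lamplighter" "lamp_state v = lamp_state w"
  obtain xs ys where xs: "fst (lamp_state v) = {q. odd (count_list xs q)}"
      "v = ?P xs \<otimes>\<^bsub>lamplighter\<^esub> lamp_t [^]\<^bsub>lamplighter\<^esub> snd (lamp_state v)"
    and ys: "fst (lamp_state w) = {q. odd (count_list ys q)}"
      "w = ?P ys \<otimes>\<^bsub>lamplighter\<^esub> lamp_t [^]\<^bsub>lamplighter\<^esub> snd (lamp_state w)"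
    using lamp_state_normal_form vw by meson
  have "odd (count_list xs q) \<longleftrightarrow> odd (count_list ys q)" for q
    using xs(1) ys(1) vw(3) by auto
  \<comment> \<open>Both concatenations contain every index an even number of times, so
    \<open>?P xs\<close> and \<open>?P ys\<close> have the same product with \<open>?P ys\<close>,
    which can be cancelled.\<close>
  then have "?P (xs @ ys) = \<one>\<^bsub>lamplighter\<^esub>" "?P (ys @ ys) = \<one>\<^bsub>lamplighter\<^esub>"
    by (intro even_prod; simp)+
  moreover have "?P (us @ ys) = ?P us \<otimes>\<^bsub>lamplighter\<^esub> ?P ys" for us
    using foldr_mult_append[of "map ?c us" "map ?c ys"] word_class_closed by (simp add: image_subset_iff)
  ultimately have "?P xs \<otimes>\<^bsub>lamplighter\<^esub> ?P ys = ?P ys \<otimes>\<^bsub>lamplighter\<^esub> ?P ys"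
    by (simp only:)
  then have "?P xs = ?P ys" by (simp only: right_cancel P_closed)
  then show "v = w" using xs(2) ys(2) vw(3) by simp
qed

section \<open>The length of a lamp state\<close>

definition hull_max :: "lamp_state \<Rightarrow> int" where
  "hull_max s = Max ({0, snd s} \<union> fst s)"

text \<open>Lamp \<open>x\<close> is the edge from \<open>x - 1\<close> to \<open>x\<close>, so its
  left endpoint \<open>x - 1\<close> enters here.\<close>

definition hull_min :: "lamp_state \<Rightarrow> int" where
  "hull_min s = Min ({0, snd s} \<union> (\<lambda>x. x - 1) ` fst s)"

text \<open>A shortest path crosses every edge of the hull twice, except those between 0 and the
  final position, which it crosses once.\<close>

definition tour :: "lamp_state \<Rightarrow> int" where
  "tour s = 2 * (hull_max s - hull_min s) - \<bar>snd s\<bar>"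

section \<open>Unit steps and the hull away from the crossed edge\<close>

fun right :: "bool \<Rightarrow> lamp_state \<Rightarrow> lamp_state" where
  "right b (S, p) = (if b then toggle (p + 1) S else S, p + 1)"

text \<open>The inverse of \<open>ta\<close> applies \<open>a\<close> before moving, so lamp
  \<open>p\<close> is toggled: the edge that the step crosses.\<close>

fun left :: "bool \<Rightarrow> lamp_state \<Rightarrow> lamp_state" where
  "left b (S, p) = (if b then toggle p S else S, p - 1)"

text \<open>The contribution of 0 and of all lamps other than \<open>q\<close>. A step across edge
  \<open>q\<close> leaves \<open>off_max S q\<close> and \<open>off_min S q\<close> unchanged, so
  the hulls before and after the step can be compared through them.\<close>

definition off_max :: "int set \<Rightarrow> int \<Rightarrow> int" where
  "off_max S q = Max (insert 0 (S - {q}))"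

definition off_min :: "int set \<Rightarrow> int \<Rightarrow> int" where
  "off_min S q = Min (insert 0 ((\<lambda>x. x - 1) ` (S - {q})))"

lemma off_toggle [simp]:
  "off_max (toggle q S) q = off_max S q" "off_min (toggle q S) q = off_min S q"
  by (simp_all add: off_max_def off_min_def)

text \<open>Edge \<open>q\<close> has endpoints \<open>q - 1\<close> and \<open>q\<close>, and the
  position is one of them. Whether lamp \<open>q\<close> is lit therefore matters only for the
  endpoint on the other side. The last two facts hold because lamp \<open>q\<close> is left out:
  only 0 can supply the value in question.\<close>

lemma hull_split:
  assumes "finite S"
  shows "hull_max (S, p) = max (off_max S p) p"
    and "hull_max (S, p) = max (off_max S (p + 1)) (p + of_bool (p + 1 \<in> S))"
    and "hull_min (S, p) = min (off_min S p) (p - of_bool (p \<in> S))"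
    and "hull_min (S, p) = min (off_min S (p + 1)) p"
    and "off_max S q \<ge> 0" "off_min S q \<le> 0" "off_max S q = q \<longrightarrow> q = 0" "off_min S q = q - 1 \<longrightarrow> q = 1"
proof -
  \<comment> \<open>Each maximum or minimum is described as a bound that is attained, which turns
    the equations into membership checks.\<close>
  have A: "off_max S q = n \<longleftrightarrow> (\<forall>x\<in>S - {q}. x \<le> n) \<and> 0 \<le> n \<and> (n = 0 \<or> n \<in> S - {q})" for q n
    unfolding off_max_def using assms(1) by (subst Max_eq_iff) auto
  have img: "n \<in> (\<lambda>x. x - 1) ` T \<longleftrightarrow> n + 1 \<in> T" for n and T :: "int set"
    by (auto intro: image_eqI[of _ _ "n + 1"])
  have B: "off_min S q = n \<longleftrightarrow> (\<forall>x\<in>S - {q}. n \<le> x - 1) \<and> n \<le> 0 \<and> (n = 0 \<or> n + 1 \<in> S - {q})" for q n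
    unfolding off_min_def using assms(1) by (subst Min_eq_iff) (auto simp: img)
  have M: "hull_max (S, p) = n \<longleftrightarrow> (\<forall>x\<in>S. x \<le> n) \<and> 0 \<le> n \<and> p \<le> n \<and> (n = 0 \<or> n = p \<or> n \<in> S)" for n
    unfolding hull_max_def using assms(1) by (subst Max_eq_iff) auto
  have m: "hull_min (S, p) = n \<longleftrightarrow>
      (\<forall>x\<in>S. n \<le> x - 1) \<and> n \<le> 0 \<and> n \<le> p \<and> (n = 0 \<or> n = p \<or> n + 1 \<in> S)" for n
    unfolding hull_min_def using assms(1) by (subst Min_eq_iff) (auto simp: img)
  have A': "(\<forall>x\<in>S - {q}. x \<le> off_max S q) \<and> 0 \<le> off_max S q \<and> (off_max S q = 0 \<or> off_max S q \<in> S - {q})" for q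
    using A by blast
  have B': "(\<forall>x\<in>S - {q}. off_min S q \<le> x - 1) \<and> off_min S q \<le> 0 \<and> (off_min S q = 0 \<or> off_min S q + 1 \<in> S - {q})" for q
    using B by blast
  have upper: "x \<le> max (off_max S p) p" "x \<le> max (off_max S (p + 1)) (p + of_bool (p + 1 \<in> S))"
    if "x \<in> S" for x
  proof -
    have "x = p \<or> x \<le> off_max S p" "x = p + 1 \<or> x \<le> off_max S (p + 1)" using A' that by blast+
    then show "x \<le> max (off_max S p) p" "x \<le> max (off_max S (p + 1)) (p + of_bool (p + 1 \<in> S))"
      using that by (auto simp: le_max_iff_disj)
  qed
  show "hull_max (S, p) = max (off_max S p) p"
    unfolding M
  proof (intro conjI)
    show "\<forall>x\<in>S. x \<le> max (off_max S p) p"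
      using upper(1) by blast
  qed (use A'[of p] in \<open>auto simp: max_def\<close>)
  show "hull_max (S, p) = max (off_max S (p + 1)) (p + of_bool (p + 1 \<in> S))"
    unfolding M
  proof (intro conjI)
    show "\<forall>x\<in>S. x \<le> max (off_max S (p + 1)) (p + of_bool (p + 1 \<in> S))"
      using upper(2) by blast
  qed (use A'[of "p + 1"] in \<open>auto simp: max_def\<close>)
  have lower: "min (off_min S p) (p - of_bool (p \<in> S)) \<le> x - 1" "min (off_min S (p + 1)) p \<le> x - 1"
    if "x \<in> S" for x
  proof -
    have "x = p \<or> off_min S p \<le> x - 1" "x = p + 1 \<or> off_min S (p + 1) \<le> x - 1" using B' that by blast+
    then show "min (off_min S p) (p - of_bool (p \<in> S)) \<le> x - 1" "min (off_min S (p + 1)) p \<le> x - 1"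
      using that by (auto simp: min_le_iff_disj)
  qed
  show "hull_min (S, p) = min (off_min S p) (p - of_bool (p \<in> S))"
    unfolding m
  proof (intro conjI)
    show "\<forall>x\<in>S. min (off_min S p) (p - of_bool (p \<in> S)) \<le> x - 1"
      using lower(1) by blast
  qed (use B'[of p] in \<open>auto simp: min_def\<close>)
  show "hull_min (S, p) = min (off_min S (p + 1)) p"
    unfolding m
  proof (intro conjI)
    show "\<forall>x\<in>S. min (off_min S (p + 1)) p \<le> x - 1"
      using lower(2) by blast
  qed (use B'[of "p + 1"] in \<open>auto simp: min_def\<close>)
  show "off_max S q \<ge> 0" "off_min S q \<le> 0" "off_max S q = q \<longrightarrow> q = 0" "off_min S q = q - 1 \<longrightarrow> q = 1"
    using A'[of q] B'[of q] by auto
qed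

lemma left_right: "left b (right b s) = s" "right b (left b s) = s"
  by (cases s; simp)+

text \<open>The crossed edge \<open>p + 1\<close> now lies behind the position, and its lamp is lit
  afterwards exactly when \<open>(p + 1 \<in> S) \<noteq> b\<close>.\<close>

lemma hull_right:
  assumes "finite S"
  shows "hull_max (right b (S, p)) = max (off_max S (p + 1)) (p + 1)"
    and "hull_min (right b (S, p)) = min (off_min S (p + 1)) (p + 1 - of_bool ((p + 1 \<in> S) \<noteq> b))"
proof -
  have fin: "finite (toggle (p + 1) S)" using assms by simp
  note h = hull_split(1,3)[OF assms, of "p + 1"] hull_split(1,3)[OF fin, of "p + 1"]
  show "hull_max (right b (S, p)) = max (off_max S (p + 1)) (p + 1)"
    and "hull_min (right b (S, p)) = min (off_min S (p + 1)) (p + 1 - of_bool ((p + 1 \<in> S) \<noteq> b))"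
    using h by (cases b; simp)+
qed

lemma hull_left:
  assumes "finite S"
  shows "hull_max (left b (S, p)) = max (off_max S p) (p - 1 + of_bool ((p \<in> S) \<noteq> b))"
    and "hull_min (left b (S, p)) = min (off_min S p) (p - 1)"
proof -
  have fin: "finite (toggle p S)" using assms by simp
  note h = hull_split(2,4)[OF assms, of "p - 1"] hull_split(2,4)[OF fin, of "p - 1"]
  show "hull_max (left b (S, p)) = max (off_max S p) (p - 1 + of_bool ((p \<in> S) \<noteq> b))"
    and "hull_min (left b (S, p)) = min (off_min S p) (p - 1)"
    using h by (cases b; simp)+
qed

lemma snd_right [simp]: "snd (right b s) = snd s + 1"
  and snd_left [simp]: "snd (left b s) = snd s - 1"
  by (cases s; simp)+

lemma finite_fst_step [simp]:
  "finite (fst (right b s)) \<longleftrightarrow> finite (fst s)" "finite (fst (left b s)) \<longleftrightarrow> finite (fst s)"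
  by (cases s; simp)+

section \<open>Change of the tour under a step\<close>

lemma tour_nonneg:
  assumes "finite (fst s)"
  shows "tour s \<ge> 0"
proof -
  obtain S p where s: "s = (S, p)" by (cases s)
  with assms have "finite S" by simp
  with hull_split(1,4)[OF this, of p] hull_split(5,6)[OF this]
  have "hull_max s \<ge> 0" "hull_max s \<ge> snd s" "hull_min s \<le> 0" "hull_min s \<le> snd s"
    by (simp_all add: s le_max_iff_disj min_le_iff_disj)
  then show ?thesis unfolding tour_def by (cases "snd s \<ge> 0") simp_all
qed

text \<open>For \<open>p \<ge> 0\<close> the hull minimum stays put, the maximum grows by 0 or 1 and
  the absolute position grows by 1. For \<open>p < 0\<close> the maximum stays put, the minimum
  grows by 0 or 1 and the absolute position drops by 1.\<close>

lemma tour_right: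
  assumes "finite (fst s)"
  shows "\<bar>tour (right b s) - tour s\<bar> \<le> 1"
proof -
  obtain S p where s: "s = (S, p)" by (cases s)
  with assms have fin: "finite S" by simp
  \<comment> \<open>Truth values become integers between 0 and 1, so that linear arithmetic with
    \<open>max\<close>, \<open>min\<close> and absolute values remains.\<close>
  define c :: int where "c = of_bool (p + 1 \<in> S)"
  define d :: int where "d = of_bool ((p + 1 \<in> S) \<noteq> b)"
  have "0 \<le> c" "c \<le> 1" "0 \<le> d" "d \<le> 1" by (simp_all add: c_def d_def)
  with hull_split(2,4)[OF fin, of p] hull_split(5,6)[OF fin, of "p + 1"] hull_right[OF fin, of b p]
  show ?thesis
    unfolding tour_def s snd_right snd_conv c_def[symmetric] d_def[symmetric]
    by (smt (verit))
qed

lemma tour_left: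
  assumes "finite (fst s)"
  shows "\<bar>tour (left b s) - tour s\<bar> \<le> 1"
  using tour_right[of "left b s" b] assms by (simp add: left_right abs_minus_commute)

text \<open>Away from 0, the lamplighter continues outward while the hull extends beyond
  \<open>p\<close>, and otherwise steps back towards 0. At 0, a step towards a nonempty side of the
  hull shortens the tour.\<close>

lemma tour_descent:
  assumes "finite (fst s)" "s \<noteq> ({}, 0)"
  shows "\<exists>b. tour (right b s) < tour s \<or> tour (left b s) < tour s"
proof -
  obtain S p where s: "s = (S, p)" by (cases s)
  with assms have fin: "finite S" by simp
  have nontriv: "p \<noteq> 0 \<or> hull_max s > 0 \<or> hull_min s < 0"
  proof (rule ccontr)
    assume triv: "\<not> ?thesis"
    have "x \<le> hull_max s" "hull_min s \<le> x - 1" if "x \<in> S" for x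
      unfolding hull_max_def hull_min_def using that fin s by (intro Max_ge Min_le; auto)+
    then have "S = {}" using triv by fastforce
    with triv assms(2) show False by (simp add: s)
  qed
  \<comment> \<open>These choices switch off the lamp of the crossed edge, so that the edge left
    behind does not keep the hull large.\<close>
  let ?b = "p + 1 \<in> S" and ?c = "p \<in> S"
  have "hull_max (left ?c s) = max (off_max S p) (p - 1)"
    "hull_min (left ?c s) = min (off_min S p) (p - 1)"
    "hull_max (right ?b s) = max (off_max S (p + 1)) (p + 1)"
    "hull_min (right ?b s) = min (off_min S (p + 1)) (p + 1)"
    using hull_left[OF fin, of ?c p] hull_right[OF fin, of ?b p] by (simp_all add: s)
  moreover define c :: int where "c = of_bool (p + 1 \<in> S)"
  moreover define d :: int where "d = of_bool (p \<in> S)"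
  moreover have "0 \<le> c" "c \<le> 1" "0 \<le> d" "d \<le> 1" by (simp_all add: c_def d_def)
  \<comment> \<open>The facts \<open>hull_split(7,8)\<close> make the hull shrink on a step back: if
    \<open>p > 0\<close> is the maximum, everything apart from lamp \<open>p\<close> ends below
    \<open>p\<close>, and likewise on the negative side.\<close>
  moreover note nontriv hull_split(1-4)[OF fin, of p, folded s c_def d_def]
    hull_split(5-8)[OF fin, of p] hull_split(5-8)[OF fin, of "p + 1"]
  moreover have "snd s = p" by (simp add: s)
  ultimately have "tour (right ?b s) < tour s \<or> tour (left ?c s) < tour s"
    unfolding tour_def snd_right snd_left by (smt (verit))
  then show ?thesis by blast
qed

text \<open>For \<open>p \<noteq> 0\<close> the two assumptions exclude each other. For
  \<open>p = 0\<close> a right step yields the hull maximum \<open>max (off_max S 1) 1\<close> and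
  the hull minimum \<open>off_min S 1\<close>, whichever Boolean is used.\<close>

lemma tour_both_sides:
  assumes "finite (fst s)" "tour (right b s) < tour s" "tour (left b s) < tour s"
  shows "tour (right (\<not> b) s) < tour s"
proof -
  obtain S p where s: "s = (S, p)" by (cases s)
  with assms have fin: "finite S" by simp
  have p: "snd s = p" by (simp add: s)
  define c :: int where "c = of_bool (p + 1 \<in> S)"
  define d :: int where "d = of_bool (p \<in> S)"
  define e :: int where "e = of_bool ((p + 1 \<in> S) \<noteq> b)"
  define e' :: int where "e' = of_bool ((p + 1 \<in> S) \<noteq> (\<not> b))"
  define f :: int where "f = of_bool ((p \<in> S) \<noteq> b)"
  note defs = c_def d_def e_def e'_def f_def
  have bounds: "0 \<le> c" "c \<le> 1" "0 \<le> d" "d \<le> 1" "0 \<le> e" "e \<le> 1" "0 \<le> e'" "e' \<le> 1" "0 \<le> f" "f \<le> 1"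
    by (simp_all add: defs)
  note hulls = hull_split(1-4)[OF fin, of p, folded s defs]
    hull_split(5,6)[OF fin, of p] hull_split(5,6)[OF fin, of "p + 1"]
    hull_right[OF fin, of b p, folded s defs] hull_right[OF fin, of "\<not> b" p, folded s defs]
    hull_left[OF fin, of b p, folded s defs]
  show ?thesis
    using assms(2,3) bounds hulls unfolding tour_def snd_right snd_left p
    by (smt (verit))
qed

section \<open>Word length in the lamplighter group\<close>

definition lamp_gens :: "lamp_gen word set set" where
  "lamp_gens = {lamp_t, lamp_t \<otimes>\<^bsub>lamplighter\<^esub> lamp_a}"

text \<open>The Boolean index agrees with that of \<open>right\<close> and \<open>left\<close>, so
  both generators are handled at once.\<close>

definition mover :: "bool \<Rightarrow> lamp_gen word set" where
  "mover b = (if b then lamp_t \<otimes>\<^bsub>lamplighter\<^esub> lamp_a else lamp_t)"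

lemma lamp_gens_eq: "lamp_gens = range mover"
  by (auto simp: lamp_gens_def mover_def)

lemma mover_closed: "mover b \<in> carrier lamplighter"
proof -
  interpret group lamplighter by (rule group_lamplighter)
  show ?thesis using lamp_closed by (simp add: mover_def)
qed

lemma lamp_state_mover:
  assumes "w \<in> carrier lamplighter"
  shows "lamp_state (w \<otimes>\<^bsub>lamplighter\<^esub> mover b) = right b (lamp_state w)"
    and "lamp_state (w \<otimes>\<^bsub>lamplighter\<^esub> inv\<^bsub>lamplighter\<^esub> mover b) = left b (lamp_state w)"
proof -
  define u where "u = (gen_t, True) # (if b then [(gen_a, True)] else [])"
  have "mover b = word_class lamplighter_relators u"
    by (simp add: mover_def u_def lamp_t_def lamp_a_def lamplighter_def mult_word_class)
  moreover from this
  have "inv\<^bsub>lamplighter\<^esub> mover b = word_class lamplighter_relators (word_inv u)"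
    by (simp add: lamplighter_def inv_word_class)
  ultimately show "lamp_state (w \<otimes>\<^bsub>lamplighter\<^esub> mover b) = right b (lamp_state w)"
    and "lamp_state (w \<otimes>\<^bsub>lamplighter\<^esub> inv\<^bsub>lamplighter\<^esub> mover b) = left b (lamp_state w)"
    using assms by (cases "lamp_state w"; simp add: lamp_state_mult u_def word_inv_def)+
qed

lemma word_length_lamplighter:
  assumes "w \<in> carrier lamplighter"
  shows "int (word_length lamplighter lamp_gens w) = tour (lamp_state w)"
proof -
  interpret group lamplighter by (rule group_lamplighter)
  have "word_length lamplighter lamp_gens w = nat (tour (lamp_state w))"
  proof (rule word_length_eqI)
    show "lamp_gens \<subseteq> carrier lamplighter"
      by (auto simp: lamp_gens_eq mover_closed)
    show "nat (tour (lamp_state \<one>\<^bsub>lamplighter\<^esub>)) = 0"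
      by (simp add: lamp_state_one tour_def hull_max_def hull_min_def)
  next
    fix v x
    assume v: "v \<in> carrier lamplighter" and "x \<in> lamp_gens \<union> m_inv lamplighter ` lamp_gens"
    then obtain b where "x = mover b \<or> x = inv\<^bsub>lamplighter\<^esub> mover b"
      by (auto simp: lamp_gens_eq)
    then show "nat (tour (lamp_state (v \<otimes>\<^bsub>lamplighter\<^esub> x))) \<le> Suc (nat (tour (lamp_state v)))"
      using tour_right[OF finite_lamp_state[OF v], of b] tour_left[OF finite_lamp_state[OF v], of b]
      by (auto simp: lamp_state_mover[OF v])
  next
    fix v assume v: "v \<in> carrier lamplighter" "v \<noteq> \<one>\<^bsub>lamplighter\<^esub>"
    note fin = finite_lamp_state[OF v(1)]
    \<comment> \<open>By injectivity, only the identity has the trivial state, so every other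
      element admits a descent.\<close>
    have "lamp_state v \<noteq> ({}, 0)"
      using v inj_on_lamp_state lamp_state_one by (metis inj_onD one_closed)
    then obtain b where "tour (right b (lamp_state v)) < tour (lamp_state v)
        \<or> tour (left b (lamp_state v)) < tour (lamp_state v)"
      using tour_descent[OF fin] by blast
    \<comment> \<open>Nonnegativity ensures that the strict decrease survives the conversion by
      \<open>nat\<close>.\<close>
    moreover have "tour (right b (lamp_state v)) \<ge> 0" "tour (left b (lamp_state v)) \<ge> 0"
      using fin by (cases "lamp_state v"; auto intro: tour_nonneg)+
    ultimately show "\<exists>x \<in> lamp_gens \<union> m_inv lamplighter ` lamp_gens.
        nat (tour (lamp_state (v \<otimes>\<^bsub>lamplighter\<^esub> x))) < nat (tour (lamp_state v))"
    proof (elim disjE)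
      assume "tour (right b (lamp_state v)) < tour (lamp_state v)" "0 \<le> tour (right b (lamp_state v))"
      then show ?thesis
        by (intro bexI[of _ "mover b"]) (auto simp: lamp_state_mover[OF v(1)] lamp_gens_eq)
    next
      assume "tour (left b (lamp_state v)) < tour (lamp_state v)" "0 \<le> tour (left b (lamp_state v))"
      then show ?thesis
        by (intro bexI[of _ "inv\<^bsub>lamplighter\<^esub> mover b"])
          (auto simp: lamp_state_mover[OF v(1)] lamp_gens_eq)
    qed
  qed (rule assms)
  then show ?thesis using tour_nonneg[OF finite_lamp_state[OF assms]] by simp
qed

text \<open>Applied to the dark state at 0, the generators end at 1 and their inverses at -1, while
  lamp 1 tells the two generators apart. Hence clause (1) of a seesaw applies to the other
  generator.\<close>

lemma mover_neq: "mover (\<not> b) \<noteq> mover b" "mover c \<noteq> inv\<^bsub>lamplighter\<^esub> mover b"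
proof -
  interpret group lamplighter by (rule group_lamplighter)
  have "lamp_state (mover b) = right b ({}, 0)"
    "lamp_state (inv\<^bsub>lamplighter\<^esub> mover b) = left b ({}, 0)" for b
    using lamp_state_mover[of "\<one>\<^bsub>lamplighter\<^esub>" b] mover_closed[of b] by (simp_all add: lamp_state_one)
  note state = this
  show "mover (\<not> b) \<noteq> mover b"
    using state(1)[of b] state(1)[of "\<not> b"] by (cases b) (auto simp: toggle_def)
  show "mover c \<noteq> inv\<^bsub>lamplighter\<^esub> mover b"
    using state(1)[of c] state(2)[of b] by (metis snd_right snd_left snd_conv add.left_neutral
        diff_0 one_neq_neg_one)
qed

theorem theorem3p5:
  shows "\<not> (\<exists>w \<in> carrier lamplighter. \<exists>k > (0 :: int).
      \<exists>g \<in> {lamp_t, lamp_t \<otimes>\<^bsub>lamplighter\<^esub> lamp_a}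
             \<union> m_inv lamplighter ` {lamp_t, lamp_t \<otimes>\<^bsub>lamplighter\<^esub> lamp_a}.
        seesaw lamplighter {lamp_t, lamp_t \<otimes>\<^bsub>lamplighter\<^esub> lamp_a} w k g)"
proof
  interpret group lamplighter by (rule group_lamplighter)
  assume "\<exists>w \<in> carrier lamplighter. \<exists>k > (0 :: int).
      \<exists>g \<in> {lamp_t, lamp_t \<otimes>\<^bsub>lamplighter\<^esub> lamp_a}
             \<union> m_inv lamplighter ` {lamp_t, lamp_t \<otimes>\<^bsub>lamplighter\<^esub> lamp_a}.
        seesaw lamplighter {lamp_t, lamp_t \<otimes>\<^bsub>lamplighter\<^esub> lamp_a} w k g"
  \<comment> \<open>Any swing gives swing 1, which leaves only clause (1) to refute.\<close>
  then obtain w g where w: "w \<in> carrier lamplighter"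
    and g: "g \<in> lamp_gens \<union> m_inv lamplighter ` lamp_gens"
    and "seesaw lamplighter lamp_gens w 1 g"
    unfolding lamp_gens_def by (blast dest: seesaw_imp_swing_one)
  have gens: "lamp_gens \<subseteq> carrier lamplighter" by (auto simp: lamp_gens_eq mover_closed)
  let ?len = "word_length lamplighter lamp_gens"
  have seesaw: "int (?len (w \<otimes>\<^bsub>lamplighter\<^esub> g)) = int (?len w) - 1"
    "int (?len (w \<otimes>\<^bsub>lamplighter\<^esub> inv\<^bsub>lamplighter\<^esub> g)) = int (?len w) - 1"
    "\<And>h. h \<in> lamp_gens - {g, inv\<^bsub>lamplighter\<^esub> g} \<Longrightarrow> ?len (w \<otimes>\<^bsub>lamplighter\<^esub> h) \<ge> ?len w"
    using \<open>seesaw lamplighter lamp_gens w 1 g\<close> unfolding seesaw_swing_one_iff[OF gens] by blast+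
  obtain b where b: "g = mover b \<or> g = inv\<^bsub>lamplighter\<^esub> mover b"
    using g by (auto simp: lamp_gens_eq)
  \<comment> \<open>Replacing \<open>g\<close> by its inverse only swaps the two elements of the
    pair, so both cases for \<open>g\<close> exclude the same elements.\<close>
  then have pair: "{g, inv\<^bsub>lamplighter\<^esub> g} = {mover b, inv\<^bsub>lamplighter\<^esub> mover b}"
    using mover_closed[of b] by auto
  have len: "int (?len (w \<otimes>\<^bsub>lamplighter\<^esub> mover c)) = tour (right c (lamp_state w))"
    "int (?len (w \<otimes>\<^bsub>lamplighter\<^esub> inv\<^bsub>lamplighter\<^esub> mover c)) = tour (left c (lamp_state w))" for c
    using w mover_closed[of c] by (simp_all add: word_length_lamplighter lamp_state_mover)
  have "tour (right b (lamp_state w)) < tour (lamp_state w)"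
    "tour (left b (lamp_state w)) < tour (lamp_state w)"
    using b seesaw(1,2) mover_closed[of b]
    by (auto simp: len[symmetric] word_length_lamplighter[OF w, symmetric])
  then have "tour (right (\<not> b) (lamp_state w)) < tour (lamp_state w)"
    by (rule tour_both_sides[OF finite_lamp_state[OF w]])
  moreover have "mover (\<not> b) \<in> lamp_gens - {g, inv\<^bsub>lamplighter\<^esub> g}"
    unfolding pair using mover_neq by (auto simp: lamp_gens_eq)
  then have "?len (w \<otimes>\<^bsub>lamplighter\<^esub> mover (\<not> b)) \<ge> ?len w" by (rule seesaw(3))
  ultimately show False
    by (simp add: len[symmetric] word_length_lamplighter[OF w, symmetric])
qed

end
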